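(* Let $k\geq 3$ be an integer, and let $S$ be an ai-semiring such that $\mathsf{V}(S_7)\subseteq \mathsf{V}(S)\subseteq \mathcal{V}_k$. Then the interval $[\mathsf{V}(S),\mathsf{V}(S^0)]$ has cardinality $2^{\aleph_0}$. Moreover, this interval (ordered by inclusion) contains both a chain and an antichain of cardinality $2^{\aleph_0}$.
   Context: An ai-semiring is an algebra $(S,+,\cdot)$ with two binary operations (no constants in the signature) such that $(S,+)$ is a commutative idempotent semigroup, $(S,\cdot)$ is a semigroup, and $x(y+z)\approx xy+xz$, $(x+y)z\approx xz+yz$ hold. $\mathsf{V}(S)$ is the variety of ai-semirings generated by $S$. For ai-semiring varieties $\mathcal{A}\subseteq\mathcal{B}$, $[\mathcal{A},\mathcal{B}]$ is the class of all varieties $\mathcal{C}$ with $\mathcal{A}\subseteq\mathcal{C}\subseteq\mathcal{B}$. For an ai-semiring $S$, $S^0=S\cup\{0\}$ is the ai-semiring obtained by adjoining a new element $0$ with $s+0=0+s=s$ and $s0=0s=0$ for all $s\in S\cup\{0\}$, the operations on $S$ being preserved. (If $S$ already has an element called $0$, the adjoined one is a different new element.) $S_7$ is the 3-element ai-semiring $\{0,a,1\}$ with $x+x=x$, $x+y=0$ for $x\neq y$, and commutative multiplication in which $1$ is an identity element, $0$ is a zero element, and $a\cdot a=0$. For positive integers $m$ and $k\geq 3$, $\mathbb{H}_{k,m}$ is the $k$-uniform Kneser hypergraph: its vertex set $V_{k,m}$ consists of the $m$-element subsets of $\{1,\dots,km\}$, and its hyperedges are the sets of $k$ pairwise disjoint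 such subsets; $E_{k,m}$ denotes the set of hyperedges. With a variable $x_v$ for each vertex $v$, $\mathbf{t}_{\mathbb{H}_{k,m}}$ is the ai-semiring term that is the sum of all words $x_{v_1}x_{v_2}\cdots x_{v_k}$ with $\{v_1,\dots,v_k\}\in E_{k,m}$ (each hyperedge contributes all $k!$ orderings), and $\mathbf{q}_{\mathbb{H}_{k,m}}$ is the word $\prod_{v\in V_{k,m}}x_v$ (product taken in any fixed order). For $k\geq 3$, $\mathcal{V}_k$ is the ai-semiring variety defined by the identities $\mathbf{t}_{\mathbb{H}_{k,p}}+y^2\approx \mathbf{t}_{\mathbb{H}_{k,p}}+y^2+\mathbf{q}_{\mathbb{H}_{k,p}}$, for all primes $p$, where $y$ is a variable distinct from all the $x_v$. *)

theory Defs
  imports "HOL-Library.Equipollence" "HOL-Computational_Algebra.Primes"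
begin

section \<open>Ai-semirings\<close>

record 'a ai_alg =
  carrier :: "'a set"
  add :: "'a \<Rightarrow> 'a \<Rightarrow> 'a"
  mul :: "'a \<Rightarrow> 'a \<Rightarrow> 'a"

locale ai_semiring =
  fixes S :: "'a ai_alg"
  assumes nonempty: "carrier S \<noteq> {}"
    and add_closed: "\<lbrakk>x \<in> carrier S; y \<in> carrier S\<rbrakk> \<Longrightarrow> add S x y \<in> carrier S"
    and mul_closed: "\<lbrakk>x \<in> carrier S; y \<in> carrier S\<rbrakk> \<Longrightarrow> mul S x y \<in> carrier S"
    and add_assoc: "\<lbrakk>x \<in> carrier S; y \<in> carrier S; z \<in> carrier S\<rbrakk>
      \<Longrightarrow> add S (add S x y) z = add S x (add S y z)"
    and add_commute: "\<lbrakk>x \<in> carrier S; y \<in> carrier S\<rbrakk> \<Longrightarrow> add S x y = add S y x"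
    and add_idem: "x \<in> carrier S \<Longrightarrow> add S x x = x"
    and mul_assoc: "\<lbrakk>x \<in> carrier S; y \<in> carrier S; z \<in> carrier S\<rbrakk>
      \<Longrightarrow> mul S (mul S x y) z = mul S x (mul S y z)"
    and distrib_left: "\<lbrakk>x \<in> carrier S; y \<in> carrier S; z \<in> carrier S\<rbrakk>
      \<Longrightarrow> mul S x (add S y z) = add S (mul S x y) (mul S x z)"
    and distrib_right: "\<lbrakk>x \<in> carrier S; y \<in> carrier S; z \<in> carrier S\<rbrakk>
      \<Longrightarrow> mul S (add S x y) z = add S (mul S x z) (mul S y z)"

text \<open>The adjoined zero is \<^const>\<open>None\<close>, so it is new whatever the elements of \<open>S\<close> are.\<close>

definition adjoin_zero :: "'a ai_alg \<Rightarrow> 'a option ai_alg" where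
  "adjoin_zero S =
    \<lparr>carrier = insert None (Some ` carrier S),
     add = (\<lambda>x y. case x of None \<Rightarrow> y | Some a \<Rightarrow>
                  (case y of None \<Rightarrow> Some a | Some b \<Rightarrow> Some (add S a b))),
     mul = (\<lambda>x y. case x of None \<Rightarrow> None | Some a \<Rightarrow>
                  (case y of None \<Rightarrow> None | Some b \<Rightarrow> Some (mul S a b)))\<rparr>"

lemma ai_semiring_adjoin_zero:
  assumes "ai_semiring S"
  shows "ai_semiring (adjoin_zero S)"
proof -
  interpret ai_semiring S by fact
  show ?thesis
    by unfold_locales
      (auto simp: adjoin_zero_def add_closed mul_closed add_assoc mul_assoc add_idem
        distrib_left distrib_right intro: add_commute split: option.splits)
qed

datatype s7 = Zero7 | A7 | One7

definition S7 :: "s7 ai_alg" where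
  "S7 =
    \<lparr>carrier = UNIV,
     add = (\<lambda>x y. if x = y then x else Zero7),
     mul = (\<lambda>x y. if x = One7 then y else if y = One7 then x else Zero7)\<rparr>"

lemma ai_semiring_S7: "ai_semiring S7"
proof
  fix x y z :: s7
  show "mul S7 x (add S7 y z) = add S7 (mul S7 x y) (mul S7 x z)"
    by (cases x; cases y; cases z) (simp_all add: S7_def)
  show "mul S7 (add S7 x y) z = add S7 (mul S7 x z) (mul S7 y z)"
    by (cases x; cases y; cases z) (simp_all add: S7_def)
qed (auto simp: S7_def)

section \<open>Terms, identities and varieties\<close>

datatype 'v ai_term = Var 'v | Plus "'v ai_term" "'v ai_term" | Times "'v ai_term" "'v ai_term"

type_synonym 'v identity = "'v ai_term \<times> 'v ai_term"

primrec eval :: "'a ai_alg \<Rightarrow> ('v \<Rightarrow> 'a) \<Rightarrow> 'v ai_term \<Rightarrow> 'a" where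
  "eval S e (Var x) = e x"
| "eval S e (Plus s t) = add S (eval S e s) (eval S e t)"
| "eval S e (Times s t) = mul S (eval S e s) (eval S e t)"

definition satisfies :: "'a ai_alg \<Rightarrow> 'v identity \<Rightarrow> bool" where
  "satisfies S i \<longleftrightarrow>
    (\<forall>e. range e \<subseteq> carrier S \<longrightarrow> eval S e (fst i) = eval S e (snd i))"

text \<open>
  HOL has no class of all algebras. A variety is represented by its members whose carrier is a
  subset of a type \<open>'u\<close>. Free algebras on countably many generators are countable and determine
  the variety, so for infinite \<open>'u\<close> nothing is lost: varieties are equal or included in each other
  iff their representations are.
\<close>

definition models :: "'v identity set \<Rightarrow> 'u ai_alg set" where
  "models I = {A. ai_semiring A \<and> (\<forall>i\<in>I. satisfies A i)}"

definition variety :: "'u ai_alg set \<Rightarrow> bool" where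
  "variety V \<longleftrightarrow> (\<exists>I :: nat identity set. V = models I)"

text \<open>
  The least variety containing \<open>S\<close>. The carrier type of \<open>S\<close> need not be the type \<open>'u\<close> over
  which varieties are represented.
\<close>

definition variety_generated :: "'a ai_alg \<Rightarrow> 'u ai_alg set" where
  "variety_generated S = \<Inter> {models I | I :: nat identity set. S \<in> models I}"

lemma variety_generated_eq_models:
  assumes "ai_semiring S"
  shows "variety_generated S = models {i :: nat identity. satisfies S i}"
proof
  show "variety_generated S \<subseteq> models {i :: nat identity. satisfies S i}"
    unfolding variety_generated_def
  proof (rule Inter_lower)
    have "S \<in> models {i :: nat identity. satisfies S i}"
      using assms unfolding models_def by blast
    then show "models {i :: nat identity. satisfies S i}
        \<in> {models I | I :: nat identity set. S \<in> models I}"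
      by blast
  qed
next
  show "models {i :: nat identity. satisfies S i} \<subseteq> variety_generated S"
    unfolding variety_generated_def
  proof (rule Inter_greatest)
    fix M assume "M \<in> {models I | I :: nat identity set. S \<in> models I}"
    then obtain I :: "nat identity set" where M: "M = models I" and I: "S \<in> models I"
      by blast
    from I have "I \<subseteq> {i. satisfies S i}"
      unfolding models_def by blast
    then show "models {i :: nat identity. satisfies S i} \<subseteq> M"
      unfolding M models_def by blast
  qed
qed

lemma variety_variety_generated:
  assumes "ai_semiring S"
  shows "variety (variety_generated S)"
  unfolding variety_def using variety_generated_eq_models[OF assms] by blast

definition variety_interval :: "'u ai_alg set \<Rightarrow> 'u ai_alg set \<Rightarrow> 'u ai_alg set set" where
  "variety_interval V W = {U. variety U \<and> V \<subseteq> U \<and> U \<subseteq> W}"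

section \<open>Kneser hypergraphs and their identities\<close>

definition kneser_vertices :: "nat \<Rightarrow> nat \<Rightarrow> nat set set" where
  "kneser_vertices k m = {v. v \<subseteq> {1..k * m} \<and> card v = m}"

definition kneser_edges :: "nat \<Rightarrow> nat \<Rightarrow> nat set set set" where
  "kneser_edges k m = {E. E \<subseteq> kneser_vertices k m \<and> card E = k \<and> pairwise disjnt E}"

text \<open>The variables \<open>x\<^sub>v\<close> and the further variable \<open>y\<close>.\<close>

datatype kvar = X "nat set" | Y

text \<open>The signature has no constants, so sums and products are formed of nonempty lists only.\<close>

fun sum_term :: "'v ai_term list \<Rightarrow> 'v ai_term" where
  "sum_term [] = undefined"
| "sum_term [t] = t"
| "sum_term (t # u # ts) = Plus t (sum_term (u # ts))"

fun prod_term :: "'v ai_term list \<Rightarrow> 'v ai_term" where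
  "prod_term [] = undefined"
| "prod_term [t] = t"
| "prod_term (t # u # ts) = Times t (prod_term (u # ts))"

definition word :: "nat set list \<Rightarrow> kvar ai_term" where
  "word vs = prod_term (map (\<lambda>v. Var (X v)) vs)"

text \<open>
  The order of the summands is chosen arbitrarily; by commutativity and associativity of addition
  it does not affect the value of the term in an ai-semiring.
\<close>

definition kneser_t :: "nat \<Rightarrow> nat \<Rightarrow> kvar ai_term" where
  "kneser_t k m = sum_term (map word
    (SOME ws. distinct ws \<and> set ws = {vs. length vs = k \<and> set vs \<in> kneser_edges k m}))"

text \<open>
  Multiplication need not be commutative, so the order of the factors of \<open>q\<close> may matter. It is a
  parameter: \<open>ord m\<close> lists the vertices in the order in which the product is taken.
\<close>

definition vertex_orders :: "nat \<Rightarrow> (nat \<Rightarrow> nat set list) \<Rightarrow> bool" where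
  "vertex_orders k ord \<longleftrightarrow>
    (\<forall>m\<ge>1. distinct (ord m) \<and> set (ord m) = kneser_vertices k m)"

definition kneser_q :: "(nat \<Rightarrow> nat set list) \<Rightarrow> nat \<Rightarrow> kvar ai_term" where
  "kneser_q ord m = word (ord m)"

definition kneser_identity :: "nat \<Rightarrow> (nat \<Rightarrow> nat set list) \<Rightarrow> nat \<Rightarrow> kvar identity" where
  "kneser_identity k ord m =
    (let s = Plus (kneser_t k m) (Times (Var Y) (Var Y)) in (s, Plus s (kneser_q ord m)))"

definition kneser_variety :: "nat \<Rightarrow> (nat \<Rightarrow> nat set list) \<Rightarrow> 'u ai_alg set" where
  "kneser_variety k ord = models {kneser_identity k ord p | p. prime p}"

end

theory Submission
  imports Defs "HOL-Analysis.Abstract_Topology_2"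
begin

text \<open>
  For a set \<open>P\<close> of primes, let \<open>V P\<close> be the subvariety of the variety of \<open>S\<^sup>0\<close> that is defined by the
  Kneser identities for the primes in \<open>P\<close>. It contains the variety of \<open>S\<close>, since \<open>S\<close> is a subalgebra
  of \<open>S\<^sup>0\<close> and satisfies all Kneser identities. The point is that the Kneser identities are independent
  relative to the identities of \<open>S\<^sup>0\<close>, so that \<open>P \<mapsto> V P\<close> reverses inclusion in both directions and
  carries a chain and an antichain of \<open>2\<^bsup>\<aleph>\<^sub>0\<^esup>\<close> sets of primes into the interval. There are no more
  varieties than sets of identities over countably many variables.

  For independence, take the nonempty subsets of \<open>{1..k * p}\<close> whose size is a multiple of \<open>p\<close>, with
  disjoint union as product and an absorbing top element for everything else. This semiring is a
  quotient of a subalgebra of a power of \<open>S7\<close> (\<open>satisfies_set_algebra\<close>), and adjoining a zero preserves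
  inclusions of equational theories (\<open>satisfies_adjoin_zero_mono\<close>); so the semiring with adjoined zero
  satisfies all identities of \<open>S\<^sup>0\<close>. In it, setting \<open>y\<close> to the adjoined zero removes \<open>y\<^sup>2\<close>, and the
  Kneser identity for \<open>p\<close> fails if \<open>x\<^sub>v\<close> is the set \<open>v\<close>. A failure of the Kneser identity for
  \<open>q\<close>, on the other hand, needs values of the variables \<open>x\<^sub>v\<close> that define a homomorphism from the
  Kneser hypergraph with parameter \<open>q\<close> to the one with parameter \<open>p\<close>. Such a homomorphism exists only
  if \<open>q\<close> divides \<open>p\<close> (\<open>kneser_hom_dvd\<close>), by an Erdos--Ko--Rado argument that uses \<open>k \<ge> 3\<close>
  (\<open>exact_transversal_is_star\<close>), and hence not for distinct primes.
\<close>

section \<open>Copies of algebras and renamed variables\<close>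

lemma eval_in_carrier:
  assumes "ai_semiring A" "range e \<subseteq> carrier A"
  shows "eval A e t \<in> carrier A"
proof -
  interpret ai_semiring A by fact
  show ?thesis
    using assms(2) by (induction t) (auto intro: add_closed mul_closed)
qed

lemma eval_cong:
  assumes "\<And>x. x \<in> set_ai_term t \<Longrightarrow> e x = e' x"
  shows "eval A e t = eval A e' t"
  using assms by (induction t) auto

lemma eval_map_ai_term: "eval A e (map_ai_term r t) = eval A (e \<circ> r) t"
  by (induction t) auto

definition copy :: "('a \<Rightarrow> 'b) \<Rightarrow> 'a ai_alg \<Rightarrow> 'b ai_alg" where
  "copy g A =
    (let h = inv_into (carrier A) g in
     \<lparr>carrier = g ` carrier A,
      add = (\<lambda>x y. g (add A (h x) (h y))),
      mul = (\<lambda>x y. g (mul A (h x) (h y)))\<rparr>)"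

lemma copy_sel:
  assumes "inj_on g (carrier A)"
  shows "carrier (copy g A) = g ` carrier A"
    and "\<lbrakk>x \<in> carrier A; y \<in> carrier A\<rbrakk> \<Longrightarrow> add (copy g A) (g x) (g y) = g (add A x y)"
    and "\<lbrakk>x \<in> carrier A; y \<in> carrier A\<rbrakk> \<Longrightarrow> mul (copy g A) (g x) (g y) = g (mul A x y)"
  using assms by (simp_all add: copy_def Let_def)

lemma ai_semiring_copy:
  assumes "ai_semiring A" "inj_on g (carrier A)"
  shows "ai_semiring (copy g A)"
proof -
  interpret ai_semiring A by fact
  show ?thesis
    by unfold_locales
      (auto simp: copy_sel[OF assms(2)] nonempty add_closed mul_closed add_assoc mul_assoc add_idem
        distrib_left distrib_right, metis add_commute)
qed

lemma satisfies_copy_iff: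
  assumes "ai_semiring A" "inj_on g (carrier A)"
  shows "satisfies (copy g A) i \<longleftrightarrow> satisfies A i"
proof -
  interpret ai_semiring A by fact
  have eval: "eval (copy g A) (g \<circ> e) t = g (eval A e t)" if "range e \<subseteq> carrier A" for e t
    using eval_in_carrier[OF assms(1) that] that
    by (induction t) (auto simp: copy_sel[OF assms(2)])
  show ?thesis
  proof
    assume copy: "satisfies (copy g A) i"
    show "satisfies A i"
      unfolding satisfies_def
    proof (intro allI impI)
      fix e :: "'c \<Rightarrow> 'a" assume e: "range e \<subseteq> carrier A"
      then have "range (g \<circ> e) \<subseteq> carrier (copy g A)"
        by (auto simp: copy_sel[OF assms(2)])
      then have "g (eval A e (fst i)) = g (eval A e (snd i))"
        using copy eval[OF e] unfolding satisfies_def by metis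
      then show "eval A e (fst i) = eval A e (snd i)"
        using assms(2) eval_in_carrier[OF assms(1) e] by (auto dest: inj_onD)
    qed
  next
    assume A: "satisfies A i"
    show "satisfies (copy g A) i"
      unfolding satisfies_def
    proof (intro allI impI)
      fix e :: "'c \<Rightarrow> 'b" assume e: "range e \<subseteq> carrier (copy g A)"
      define e' where "e' = inv_into (carrier A) g \<circ> e"
      have "range e' \<subseteq> carrier A" "e = g \<circ> e'"
        using e by (auto simp: e'_def copy_sel[OF assms(2)] image_subset_iff
            inv_into_into f_inv_into_f fun_eq_iff)
      then show "eval (copy g A) e (fst i) = eval (copy g A) e (snd i)"
        using A eval unfolding satisfies_def by metis
    qed
  qed
qed

lemma finite_algebra_copy:
  assumes "infinite (UNIV :: 'u set)" "ai_semiring A" "finite (carrier A)"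
  obtains B :: "'u ai_alg"
  where "ai_semiring B" "\<And>i :: 'v identity. satisfies B i \<longleftrightarrow> satisfies A i"
proof -
  obtain g :: "_ \<Rightarrow> 'u" where "inj_on g (carrier A)"
    using finite_lepoll_infinite[OF assms(1,3)] by (auto simp: lepoll_def)
  with assms(2) show ?thesis
    using that[of "copy g A"] ai_semiring_copy satisfies_copy_iff by blast
qed

text \<open>
  The inclusion of represented varieties is turned into the inclusion of equational theories by
  placing a copy of the finite generator into the universe.
\<close>

lemma satisfies_if_variety_generated_subset:
  assumes "infinite (UNIV :: 'u set)"
    and "ai_semiring A" "finite (carrier A)" "ai_semiring S"
    and sub: "(variety_generated A :: 'u ai_alg set) \<subseteq> variety_generated S"
    and "satisfies S (i :: nat identity)"
  shows "satisfies A i"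
proof -
  obtain B :: "'u ai_alg"
    where B: "ai_semiring B" "\<And>i :: nat identity. satisfies B i \<longleftrightarrow> satisfies A i"
    using finite_algebra_copy[OF assms(1-3)] by blast
  then have "B \<in> variety_generated A"
    unfolding variety_generated_eq_models[OF assms(2)] models_def by blast
  then have "B \<in> variety_generated S"
    using sub by blast
  with assms(6) B(2) show ?thesis
    unfolding variety_generated_eq_models[OF assms(4)] models_def by blast
qed

definition identity_vars :: "'v identity \<Rightarrow> 'v set" where
  "identity_vars i = set_ai_term (fst i) \<union> set_ai_term (snd i)"

lemma finite_identity_vars: "finite (identity_vars i)"
proof -
  have "finite (set_ai_term t)" for t :: "'v ai_term"
    by (induction t) auto
  then show ?thesis
    by (simp add: identity_vars_def)
qed

text \<open>
  Varieties are cut out by identities over the variables \<open>nat\<close>, so identities over other variables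
  are first renamed.
\<close>

definition nat_identity :: "'v identity \<Rightarrow> nat identity" where
  "nat_identity i =
    (let r = to_nat_on (identity_vars i) in map_prod (map_ai_term r) (map_ai_term r) i)"

lemma satisfies_nat_identity_iff:
  fixes A :: "'a ai_alg" and i :: "'v identity"
  shows "satisfies A (nat_identity i) \<longleftrightarrow> satisfies A i"
proof -
  let ?V = "identity_vars i"
  let ?r = "to_nat_on ?V"
  have r: "inj_on ?r ?V"
    by (intro inj_on_to_nat_on countable_finite finite_identity_vars)
  have eval: "eval A e (fst (nat_identity i)) = eval A (e \<circ> ?r) (fst i)"
    "eval A e (snd (nat_identity i)) = eval A (e \<circ> ?r) (snd i)" for e
    by (simp_all add: nat_identity_def Let_def eval_map_ai_term)
  show ?thesis
  proof
    assume renamed: "satisfies A (nat_identity i)"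
    show "satisfies A i"
      unfolding satisfies_def
    proof (intro allI impI)
      fix e :: "'v \<Rightarrow> 'a" assume e: "range e \<subseteq> carrier A"
      let ?e = "e \<circ> inv_into ?V ?r"
      have "eval A (?e \<circ> ?r) (fst i) = eval A e (fst i)"
        "eval A (?e \<circ> ?r) (snd i) = eval A e (snd i)"
        using inv_into_f_f[OF r] by (auto intro!: eval_cong simp: identity_vars_def)
      moreover have "range ?e \<subseteq> carrier A"
        using e by auto
      ultimately show "eval A e (fst i) = eval A e (snd i)"
        using renamed unfolding satisfies_def eval by metis
    qed
  next
    assume i: "satisfies A i"
    have "range (e \<circ> ?r) \<subseteq> carrier A" if "range e \<subseteq> carrier A" for e
      using that by auto
    with i show "satisfies A (nat_identity i)"
      unfolding satisfies_def eval by blast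
  qed
qed

section \<open>Identities of semirings with an adjoined zero\<close>

definition term_algebra :: "'v ai_term ai_alg" where
  "term_algebra = \<lparr>carrier = UNIV, add = Plus, mul = Times\<rparr>"

text \<open>
  The term that remains of \<open>t\<close> if the variables in \<open>Z\<close> are set to the adjoined zero, or \<open>None\<close>
  if \<open>t\<close> then zero_outes. Adjoining a zero to the term algebra gives the required rules.
\<close>

definition zero_out :: "'v set \<Rightarrow> 'v ai_term \<Rightarrow> 'v ai_term option" where
  "zero_out Z = eval (adjoin_zero term_algebra) (\<lambda>x. if x \<in> Z then None else Some (Var x))"

lemma zero_out_empty: "zero_out {} t = Some t"
  by (induction t) (simp_all add: zero_out_def adjoin_zero_def term_algebra_def)

lemma eval_adjoin_zero:
  "eval (adjoin_zero A) (\<lambda>x. if x \<in> Z then None else Some (e x)) t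
    = map_option (eval A e) (zero_out Z t)"
  unfolding zero_out_def
proof (induction t)
  case (Var x)
  show ?case
    by simp
next
  case (Plus s t)
  then show ?case
    by (simp add: adjoin_zero_def term_algebra_def split: option.split)
next
  case (Times s t)
  then show ?case
    by (simp add: adjoin_zero_def term_algebra_def split: option.split)
qed

text \<open>
  An assignment into \<open>A\<^sup>0\<close> consists of the set \<open>Z\<close> of the variables sent to the adjoined zero and of an
  assignment into \<open>A\<close> of the others. So the identities of \<open>A\<^sup>0\<close> depend on those of \<open>A\<close> only.
\<close>

lemma satisfies_adjoin_zero_iff:
  assumes "carrier A \<noteq> {}"
  shows "satisfies (adjoin_zero A) (s, t) \<longleftrightarrow>
    (\<forall>Z. rel_option (\<lambda>s' t'. satisfies A (s', t')) (zero_out Z s) (zero_out Z t))"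
proof
  assume sat: "satisfies (adjoin_zero A) (s, t)"
  have eq: "map_option (eval A e) (zero_out Z s) = map_option (eval A e) (zero_out Z t)"
    if e: "range e \<subseteq> carrier A" for Z e
  proof -
    have "range (\<lambda>x. if x \<in> Z then None else Some (e x)) \<subseteq> carrier (adjoin_zero A)"
      using e by (auto simp: adjoin_zero_def)
    then show ?thesis
      using sat unfolding satisfies_def eval_adjoin_zero[symmetric] by simp
  qed
  obtain c where "c \<in> carrier A"
    using assms by blast
  then have "range (\<lambda>_. c) \<subseteq> carrier A"
    by auto
  note none = eq[OF this]
  show "\<forall>Z. rel_option (\<lambda>s' t'. satisfies A (s', t')) (zero_out Z s) (zero_out Z t)"
  proof
    fix Z
    show "rel_option (\<lambda>s' t'. satisfies A (s', t')) (zero_out Z s) (zero_out Z t)"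
      using none[of Z] eq[of _ Z]
      by (cases "zero_out Z s"; cases "zero_out Z t") (auto simp: satisfies_def)
  qed
next
  assume rel: "\<forall>Z. rel_option (\<lambda>s' t'. satisfies A (s', t')) (zero_out Z s) (zero_out Z t)"
  obtain c where c: "c \<in> carrier A"
    using assms by blast
  show "satisfies (adjoin_zero A) (s, t)"
    unfolding satisfies_def
  proof (intro allI impI)
    fix e :: "'b \<Rightarrow> 'a option" assume e: "range e \<subseteq> carrier (adjoin_zero A)"
    define Z where "Z = {x. e x = None}"
    \<comment> \<open>The default \<open>c\<close> only keeps the assignment inside the carrier.\<close>
    define e' where "e' x = (case e x of None \<Rightarrow> c | Some a \<Rightarrow> a)" for x
    have e_eq: "e = (\<lambda>x. if x \<in> Z then None else Some (e' x))"
      by (auto simp: Z_def e'_def split: option.splits)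
    have "e' x \<in> carrier A" for x
      using e c range_subsetD[OF e, of x] by (auto simp: e'_def adjoin_zero_def split: option.splits)
    then have e': "range e' \<subseteq> carrier A"
      by auto
    have "map_option (eval A e') (zero_out Z s) = map_option (eval A e') (zero_out Z t)"
      using spec[OF rel, of Z] e'
      by (cases "zero_out Z s"; cases "zero_out Z t") (auto simp: satisfies_def)
    then show "eval (adjoin_zero A) e (fst (s, t)) = eval (adjoin_zero A) e (snd (s, t))"
      unfolding e_eq eval_adjoin_zero by simp
  qed
qed

lemma satisfies_if_satisfies_adjoin_zero:
  assumes "carrier A \<noteq> {}" "satisfies (adjoin_zero A) i"
  shows "satisfies A i"
proof (cases i)
  case (Pair s t)
  show ?thesis
    using assms(2) satisfies_adjoin_zero_iff[OF assms(1), of s t]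
    unfolding Pair by (auto simp: zero_out_empty dest: spec[of _ "{}"])
qed

lemma satisfies_adjoin_zero_mono:
  assumes "carrier A \<noteq> {}" "carrier B \<noteq> {}"
    and "\<And>i :: 'v identity. satisfies A i \<Longrightarrow> satisfies B i"
    and "satisfies (adjoin_zero A) (i :: 'v identity)"
  shows "satisfies (adjoin_zero B) i"
proof (cases i)
  case (Pair s t)
  show ?thesis
    unfolding Pair satisfies_adjoin_zero_iff[OF assms(2)]
  proof
    fix Z
    have "rel_option (\<lambda>s' t'. satisfies A (s', t')) (zero_out Z s) (zero_out Z t)"
      using assms(4) unfolding Pair satisfies_adjoin_zero_iff[OF assms(1)] by blast
    then show "rel_option (\<lambda>s' t'. satisfies B (s', t')) (zero_out Z s) (zero_out Z t)"
      by (rule option.rel_mono_strong) (rule assms(3))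
  qed
qed

section \<open>Semirings of sets under disjoint union\<close>

text \<open>
  The product is the disjoint union where it exists and the greatest element \<open>None\<close> otherwise, and
  the sum of distinct elements is \<open>None\<close>. For \<open>n = k * p\<close>, any \<open>k\<close> sets whose product differs from
  \<open>None\<close> have size \<open>p\<close> and partition \<open>{1..n}\<close>, because every element has size at least \<open>p\<close>; thus
  the factorisations of \<open>{1..n}\<close> into \<open>k\<close> factors are, up to order, the hyperedges of the Kneser
  hypergraph.
\<close>

definition set_algebra :: "nat \<Rightarrow> nat \<Rightarrow> nat set option ai_alg" where
  "set_algebra n p =
    \<lparr>carrier = insert None (Some ` {T. T \<subseteq> {1..n} \<and> T \<noteq> {} \<and> p dvd card T}),
     add = (\<lambda>x y. if x = y then x else None),
     mul = (\<lambda>x y. case x of None \<Rightarrow> None | Some T \<Rightarrow>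
                  (case y of None \<Rightarrow> None | Some U \<Rightarrow> if disjnt T U then Some (T \<union> U) else None))\<rparr>"

lemma finite_set_algebra: "finite (carrier (set_algebra n p))"
proof -
  have "finite {T. T \<subseteq> {1..n} \<and> T \<noteq> {} \<and> p dvd card T}"
    by (rule finite_subset[of _ "Pow {1..n}"]) auto
  then show ?thesis
    by (simp add: set_algebra_def)
qed

lemma set_algebra_simps:
  "add (set_algebra n p) x y = (if x = y then x else None)"
  "mul (set_algebra n p) None y = None"
  "mul (set_algebra n p) x None = None"
  "mul (set_algebra n p) (Some T) (Some U) = (if disjnt T U then Some (T \<union> U) else None)"
  by (simp_all add: set_algebra_def split: option.split)

lemma ai_semiring_set_algebra: "ai_semiring (set_algebra n p)"
proof
  fix x y z
  assume x: "x \<in> carrier (set_algebra n p)" and y: "y \<in> carrier (set_algebra n p)"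
  show "mul (set_algebra n p) x y \<in> carrier (set_algebra n p)"
  proof (cases "\<exists>T U. x = Some T \<and> y = Some U \<and> disjnt T U")
    case True
    then obtain T U where TU: "x = Some T" "y = Some U" "disjnt T U"
      by blast
    with x y have sub: "T \<subseteq> {1..n}" "U \<subseteq> {1..n}"
      by (simp_all add: set_algebra_def image_iff)
    have "finite T" "finite U"
      using finite_subset[OF sub(1)] finite_subset[OF sub(2)] by simp_all
    with TU(3) have "card (T \<union> U) = card T + card U"
      by (simp add: card_Un_disjnt)
    with x y TU show ?thesis
      by (simp add: set_algebra_def image_iff)
  next
    case False
    then show ?thesis
      by (cases x; cases y) (auto simp: set_algebra_def)
  qed
  have disjnt_Un: "disjnt (T \<union> U) W \<longleftrightarrow> disjnt T W \<and> disjnt U W"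
    "disjnt W (T \<union> U) \<longleftrightarrow> disjnt W T \<and> disjnt W U" for T U W :: "nat set"
    by (auto simp: disjnt_def)
  have cancel: "T \<union> U = T \<union> W \<longleftrightarrow> U = W" "U \<union> T = W \<union> T \<longleftrightarrow> U = W"
    if "disjnt T U" "disjnt T W" for T U W :: "nat set"
    using that by (auto simp: disjnt_def)
  show "mul (set_algebra n p) (mul (set_algebra n p) x y) z
      = mul (set_algebra n p) x (mul (set_algebra n p) y z)"
    by (cases x; cases y; cases z) (auto simp: set_algebra_simps disjnt_Un)
  show "mul (set_algebra n p) x (add (set_algebra n p) y z)
      = add (set_algebra n p) (mul (set_algebra n p) x y) (mul (set_algebra n p) x z)"
    by (cases x; cases y; cases z) (auto simp: set_algebra_simps cancel)
  show "mul (set_algebra n p) (add (set_algebra n p) x y) z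
      = add (set_algebra n p) (mul (set_algebra n p) x z) (mul (set_algebra n p) y z)"
    by (cases x; cases y; cases z) (auto simp: set_algebra_simps cancel disjnt_sym)
qed (auto simp: set_algebra_def)

lemma finite_S7: "finite (carrier S7)"
proof (rule finite_subset)
  show "carrier S7 \<subseteq> {Zero7, A7, One7}"
  proof
    show "x \<in> {Zero7, A7, One7}" for x
      by (cases x) auto
  qed
qed simp

definition collapse :: "nat \<Rightarrow> (nat \<Rightarrow> s7) \<Rightarrow> nat set option" where
  "collapse n h = (if \<exists>i\<in>{1..n}. h i = Zero7 then None else Some {i\<in>{1..n}. h i = A7})"

lemma collapse_add:
  "collapse n (\<lambda>i. add S7 (h i) (g i)) = add (set_algebra n p) (collapse n h) (collapse n g)"
proof (cases "\<forall>i\<in>{1..n}. h i = g i")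
  case True
  then have "collapse n (\<lambda>i. add S7 (h i) (g i)) = collapse n h" "collapse n g = collapse n h"
    by (auto simp: collapse_def S7_def)
  then show ?thesis
    by (simp add: set_algebra_def)
next
  case False
  then obtain i where i: "i \<in> {1..n}" "h i \<noteq> g i"
    by blast
  then have "collapse n (\<lambda>i. add S7 (h i) (g i)) = None"
    by (auto simp: collapse_def S7_def)
  moreover have "collapse n h \<noteq> collapse n g" if "collapse n h \<noteq> None" "collapse n g \<noteq> None"
  proof
    assume "collapse n h = collapse n g"
    with that have eq: "{i\<in>{1..n}. h i = A7} = {i\<in>{1..n}. g i = A7}"
      and nonzero: "h i \<noteq> Zero7" "g i \<noteq> Zero7"
      using i(1) by (auto simp: collapse_def split: if_splits)
    have "i \<in> {i\<in>{1..n}. h i = A7} \<longleftrightarrow> i \<in> {i\<in>{1..n}. g i = A7}"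
      by (simp only: eq)
    then have "h i = A7 \<longleftrightarrow> g i = A7"
      using i(1) by simp
    then show False
      using i(2) nonzero by (cases "h i"; cases "g i") simp_all
  qed
  ultimately show ?thesis
    by (cases "collapse n h"; cases "collapse n g") (auto simp: set_algebra_def)
qed

lemma collapse_mul:
  "collapse n (\<lambda>i. mul S7 (h i) (g i)) = mul (set_algebra n p) (collapse n h) (collapse n g)"
proof -
  have zero: "mul S7 a b = Zero7 \<longleftrightarrow> a = Zero7 \<or> b = Zero7 \<or> a = A7 \<and> b = A7" for a b
    by (cases a; cases b) (auto simp: S7_def)
  have a: "mul S7 a b = A7 \<longleftrightarrow> a = A7 \<and> b = One7 \<or> a = One7 \<and> b = A7" for a b
    by (cases a; cases b) (auto simp: S7_def)
  have one: "a = One7 \<longleftrightarrow> a \<noteq> Zero7 \<and> a \<noteq> A7" for a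
    by (cases a) auto
  show ?thesis
    by (auto simp: collapse_def zero a one set_algebra_def disjnt_def)
qed

text \<open>
  The tuples in \<open>S7\<^sup>n\<close> with some coordinate \<open>0\<close> form an ideal that absorbs sums. Collapsing it to a
  point makes the tuple with entries \<open>a\<close> on \<open>T\<close> and \<open>1\<close> elsewhere correspond to the set \<open>T\<close>. So the
  set algebra is a quotient of a subalgebra of a power of \<open>S7\<close>.
\<close>

lemma satisfies_set_algebra:
  assumes "n \<ge> 1" "satisfies S7 i"
  shows "satisfies (set_algebra n p) i"
  unfolding satisfies_def
proof (intro allI impI)
  fix e :: "'a \<Rightarrow> nat set option"
  assume e: "range e \<subseteq> carrier (set_algebra n p)"
  define h where "h x i = (case e x of None \<Rightarrow> Zero7 | Some T \<Rightarrow> if i \<in> T then A7 else One7)" for x i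
  have "collapse n (h x) = e x" for x
  proof (cases "e x")
    case None
    with assms(1) show ?thesis
      by (auto simp: collapse_def h_def)
  next
    case (Some T)
    then have "T \<subseteq> {1..n}"
      using range_subsetD[OF e, of x] by (auto simp: set_algebra_def)
    with Some show ?thesis
      by (auto simp: collapse_def h_def)
  qed
  then have "eval (set_algebra n p) e t = collapse n (\<lambda>i. eval S7 (\<lambda>x. h x i) t)" for t
    by (induction t) (simp_all add: collapse_add[symmetric] collapse_mul[symmetric])
  moreover have "eval S7 (\<lambda>x. h x j) (fst i) = eval S7 (\<lambda>x. h x j) (snd i)" for j
    using assms(2) by (simp add: satisfies_def S7_def)
  ultimately show "eval (set_algebra n p) e (fst i) = eval (set_algebra n p) e (snd i)"
    by simp
qed

section \<open>Homomorphisms of Kneser hypergraphs\<close>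

lemma finite_kneser_vertices: "finite (kneser_vertices k m)"
  by (rule finite_subset[of _ "Pow {1..k * m}"]) (auto simp: kneser_vertices_def)

lemma kneser_verticesD:
  assumes "v \<in> kneser_vertices k m"
  shows "v \<subseteq> {1..k * m}" "card v = m" "finite v"
  using assms finite_subset[of v "{1..k * m}"] by (auto simp: kneser_vertices_def)

lemma kneser_edgesD:
  assumes "E \<in> kneser_edges k m"
  shows "E \<subseteq> kneser_vertices k m" "card E = k" "pairwise disjnt E" "finite E"
  using assms finite_subset[OF _ finite_kneser_vertices] by (auto simp: kneser_edges_def)

lemma card_Union_disjoint_vertices:
  assumes "F \<subseteq> kneser_vertices k m" "pairwise disjnt F"
  shows "card (\<Union> F) = m * card F"
proof -
  have "card (\<Union> F) = (\<Sum>v\<in>F. card v)"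
    using assms kneser_verticesD(3) by (intro card_Union_disjoint) auto
  also have "\<dots> = (\<Sum>v\<in>F. m)"
    using assms(1) kneser_verticesD(2) by (intro sum.cong) auto
  finally show ?thesis
    by simp
qed

lemma Union_kneser_edge:
  assumes "E \<in> kneser_edges k m"
  shows "\<Union> E = {1..k * m}"
proof (rule card_subset_eq)
  note E = kneser_edgesD[OF assms]
  show "\<Union> E \<subseteq> {1..k * m}"
    using E(1) kneser_verticesD(1) by blast
  show "card (\<Union> E) = card {1..k * m}"
    using card_Union_disjoint_vertices[OF E(1,3)] E(2) by simp
qed simp

lemma extend_to_kneser_edge:
  assumes m: "m \<ge> 1"
    and F: "F \<subseteq> kneser_vertices k m" "pairwise disjnt F" "card F \<le> k"
  shows "\<exists>E\<in>kneser_edges k m. F \<subseteq> E"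
  using F
proof (induction "k - card F" arbitrary: F)
  case 0
  then have "F \<in> kneser_edges k m"
    by (auto simp: kneser_edges_def)
  then show ?case
    by blast
next
  case (Suc n)
  have fin: "finite F"
    using Suc.prems(1) finite_kneser_vertices finite_subset by blast
  have sub: "\<Union> F \<subseteq> {1..k * m}"
    using Suc.prems(1) kneser_verticesD(1) by blast
  have "m * card F + m \<le> k * m"
    using Suc.hyps(2) mult_le_mono1[of "Suc (card F)" k m] by (simp add: algebra_simps)
  then have "m \<le> card ({1..k * m} - \<Union> F)"
    using sub card_Union_disjoint_vertices[OF Suc.prems(1,2)]
    by (subst card_Diff_subset) (auto intro: finite_subset)
  then obtain v where v: "v \<subseteq> {1..k * m} - \<Union> F" "card v = m"
    using obtain_subset_with_card_n by metis
  have "v \<noteq> {}"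
    using v(2) m by auto
  then have "v \<notin> F"
    using v(1) by auto
  have "\<exists>E\<in>kneser_edges k m. insert v F \<subseteq> E"
  proof (rule Suc.hyps(1))
    show "n = k - card (insert v F)" "card (insert v F) \<le> k"
      using Suc.hyps(2) \<open>v \<notin> F\<close> fin by auto
    show "insert v F \<subseteq> kneser_vertices k m"
      using Suc.prems(1) v by (auto simp: kneser_vertices_def)
    show "pairwise disjnt (insert v F)"
      using Suc.prems(2) v(1) by (auto simp: pairwise_insert disjnt_def)
  qed
  then show ?case
    by blast
qed

text \<open>
  Walking from a member of \<open>F\<close> to a non-member by exchanging one element at a time, some single
  exchange leaves \<open>F\<close>.
\<close>

lemma exchange_leaving_family:
  assumes "A \<in> kneser_vertices k m" "B \<in> kneser_vertices k m" "A \<in> F" "B \<notin> F"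
  shows "\<exists>x y C. x \<in> {1..k * m} \<and> y \<in> {1..k * m} \<and> x \<noteq> y \<and> C \<subseteq> {1..k * m} - {x, y}
    \<and> card C = m - 1 \<and> insert x C \<in> F \<and> insert y C \<notin> F"
  using assms
proof (induction "card (A - B)" arbitrary: A rule: less_induct)
  case less
  note A = kneser_verticesD[OF less.prems(1)] and B = kneser_verticesD[OF less.prems(2)]
  have "A \<noteq> B"
    using less.prems by auto
  have "\<not> A \<subseteq> B"
    using A B \<open>A \<noteq> B\<close> card_subset_eq by metis
  moreover have "\<not> B \<subseteq> A"
    using A B \<open>A \<noteq> B\<close> card_subset_eq by metis
  ultimately obtain x y where xy: "x \<in> A" "x \<notin> B" "y \<in> B" "y \<notin> A"
    by blast
  let ?C = "A - {x}"
  let ?A' = "insert y ?C"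
  have C: "?C \<subseteq> {1..k * m} - {x, y}" "card ?C = m - 1" "insert x ?C \<in> F"
    using A xy less.prems(3) by (auto simp: insert_absorb)
  have in_range: "x \<in> {1..k * m}" "y \<in> {1..k * m}" "x \<noteq> y"
    using A B xy by auto
  show ?case
  proof (cases "?A' \<in> F")
    case False
    with C in_range show ?thesis
      by blast
  next
    case True
    have "card ?A' = m"
      using A(2,3) xy card_Suc_Diff1[OF A(3) xy(1)] by simp
    then have "?A' \<in> kneser_vertices k m"
      using C(1) in_range by (auto simp: kneser_vertices_def)
    moreover have "?A' - B \<subset> A - B"
      using xy by auto
    then have "card (?A' - B) < card (A - B)"
      using A(3) by (intro psubset_card_mono) auto
    ultimately show ?thesis
      using less.hyps less.prems True by blast
  qed
qed

lemma card_Int_eq_1_unique: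
  assumes "card (E \<inter> F) = 1" "v \<in> E" "w \<in> E" "v \<in> F" "w \<in> F"
  shows "v = w"
  by (metis assms IntI card_1_singletonE singletonD)

text \<open>
  The case \<open>k \<ge> 3\<close> of the uniqueness part of the Erdos--Ko--Rado theorem, for families that meet
  every partition exactly once; here an exchange argument suffices. Disjoint vertices \<open>A\<close> and \<open>B\<close>
  may be replaced in an edge by any disjoint \<open>A'\<close> and \<open>B'\<close> with the same union, so the number of
  them that lie in \<open>F\<close> depends on \<open>A \<union> B\<close> only. Hence if exchanging \<open>x\<close> for \<open>y\<close> leads from
  \<open>C \<union> {x}\<close> in \<open>F\<close> to \<open>C \<union> {y}\<close> outside, the same happens for each \<open>D\<close> that is disjoint from \<open>C\<close>. As
  \<open>k \<ge> 3\<close> leaves room for a set disjoint from two given ones, every \<open>D\<close> is reached from \<open>C\<close> in two such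
  steps. Therefore a vertex \<open>v\<close> without \<open>x\<close> is not in \<open>F\<close>: either it contains \<open>y\<close>, or it lies in
  an edge with some \<open>D \<union> {x}\<close>, which is the only member of \<open>F\<close> there. So the member of \<open>F\<close> in an edge
  is always the vertex that contains \<open>x\<close>.
\<close>

lemma exact_transversal_is_star:
  assumes k: "k \<ge> 3" and m: "m \<ge> 1"
    and one: "\<And>E. E \<in> kneser_edges k m \<Longrightarrow> card (E \<inter> F) = 1"
  shows "\<exists>x\<in>{1..k * m}. \<forall>v\<in>kneser_vertices k m. v \<in> F \<longleftrightarrow> x \<in> v"
proof -
  let ?N = "{1..k * m}" and ?V = "kneser_vertices k m"
  let ?c = "\<lambda>v. of_bool (v \<in> F) :: nat"
  have km: "3 * m \<le> k * m"
    using k by simp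
  have room: "\<exists>D\<subseteq>?N - W. card D = m - 1" if W: "finite W" "card W \<le> 2 * m + 1" for W
  proof -
    have "card ?N - card W \<le> card (?N - W)"
      using W(1) by (rule diff_card_le_card_Diff)
    moreover have "card ?N = k * m"
      by simp
    ultimately have "m - 1 \<le> card (?N - W)"
      using W(2) km by linarith
    then show ?thesis
      using obtain_subset_with_card_n by metis
  qed
  have insert_vertex: "insert x C \<in> ?V"
    if "x \<in> ?N" "C \<subseteq> ?N" "x \<notin> C" "card C = m - 1" for x C
    using that m finite_subset[OF that(2)] by (auto simp: kneser_vertices_def)
  have exchange: "?c A + ?c B = ?c A' + ?c B'"
    if V: "A \<in> ?V" "B \<in> ?V" "A' \<in> ?V" "B' \<in> ?V"
      and AB: "disjnt A B" "disjnt A' B'" "A \<union> B = A' \<union> B'" for A B A' B'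
  proof -
    have ne: "v \<noteq> {}" if "v \<in> ?V" for v
      using kneser_verticesD(2)[OF that] m by auto
    have "A \<noteq> B" "A' \<noteq> B'"
      using AB V ne by (auto simp: disjnt_def)
    have "\<exists>E\<in>kneser_edges k m. {A, B} \<subseteq> E"
      using m V AB k \<open>A \<noteq> B\<close>
      by (intro extend_to_kneser_edge) (auto simp: pairwise_insert disjnt_sym)
    then obtain E where E: "E \<in> kneser_edges k m" "A \<in> E" "B \<in> E"
      by auto
    note E' = kneser_edgesD[OF E(1)]
    define R where "R = E - {A, B}"
    have E_eq: "E = insert A (insert B R)" and R: "A \<notin> R" "B \<notin> R" "finite R"
      using E E' by (auto simp: R_def)
    have disj: "disjnt (A' \<union> B') C" if "C \<in> R" for C
    proof -
      have "disjnt A C" "disjnt B C"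
        using that E E'(3) by (auto simp: R_def pairwise_def)
      then show ?thesis
        unfolding AB(3)[symmetric] by (auto simp: disjnt_def)
    qed
    have R': "A' \<notin> R" "B' \<notin> R"
      using disj[of A'] disj[of B'] ne[OF V(3)] ne[OF V(4)] by (auto simp: disjnt_def)
    have "card R + 2 = k"
      using E'(2) R \<open>A \<noteq> B\<close> unfolding E_eq by simp
    have "insert A' (insert B' R) \<in> kneser_edges k m"
      unfolding kneser_edges_def
    proof (intro CollectI conjI)
      show "insert A' (insert B' R) \<subseteq> ?V"
        using V E' by (auto simp: R_def)
      show "card (insert A' (insert B' R)) = k"
        using R R' \<open>A' \<noteq> B'\<close> \<open>card R + 2 = k\<close> by simp
      have "pairwise disjnt R"
        using E'(3) unfolding R_def by (rule pairwise_subset) auto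
      then show "pairwise disjnt (insert A' (insert B' R))"
        using AB(2) disj by (auto simp: pairwise_insert disjnt_def)
    qed
    then have "card (insert A' (insert B' R) \<inter> F) = card (insert A (insert B R) \<inter> F)"
      using one E(1) E_eq by simp
    moreover have "card (insert A (insert B R) \<inter> F) = ?c A + ?c B + card (R \<inter> F)"
      using R \<open>A \<noteq> B\<close> by (auto simp: Int_insert_left)
    moreover have "card (insert A' (insert B' R) \<inter> F) = ?c A' + ?c B' + card (R \<inter> F)"
      using R R' \<open>A' \<noteq> B'\<close> by (auto simp: Int_insert_left)
    ultimately show ?thesis
      by simp
  qed
  have disjoint_exchange: "insert x D \<in> F \<and> insert y D \<notin> F"
    if "x \<in> ?N" "y \<in> ?N" "x \<noteq> y"
      and "C \<subseteq> ?N - {x, y}" "card C = m - 1" "D \<subseteq> ?N - {x, y}" "card D = m - 1" "disjnt C D"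
      and "insert x C \<in> F" "insert y C \<notin> F" for x y C D
  proof -
    have "?c (insert x C) + ?c (insert y D) = ?c (insert y C) + ?c (insert x D)"
      using that by (intro exchange insert_vertex) (auto simp: disjnt_def)
    with that(9,10) show ?thesis
      by (cases "insert x D \<in> F"; cases "insert y D \<in> F") simp_all
  qed
  obtain E where E: "E \<in> kneser_edges k m"
    using extend_to_kneser_edge[OF m, of "{}" k] by auto
  obtain A where A: "A \<in> E" "A \<in> F"
    using one[OF E] by (metis IntE card_1_singletonE insertI1)
  have "\<not> E \<subseteq> {A}"
    using kneser_edgesD(2)[OF E] k card_mono[of "{A}" E] by auto
  then obtain B where B: "B \<in> E" "B \<noteq> A"
    by blast
  then have "B \<notin> F"
    using card_Int_eq_1_unique[OF one[OF E] A(1) B(1)] A by blast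
  then obtain x y C where xy: "x \<in> ?N" "y \<in> ?N" "x \<noteq> y"
    and C: "C \<subseteq> ?N - {x, y}" "card C = m - 1" "insert x C \<in> F" "insert y C \<notin> F"
    using exchange_leaving_family[of A k m B F] A B E kneser_edgesD(1)[OF E] by blast
  have every_exchange: "insert x D \<in> F \<and> insert y D \<notin> F"
    if D: "D \<subseteq> ?N - {x, y}" "card D = m - 1" for D
  proof -
    have fin: "finite C" "finite D"
      using finite_subset[OF C(1)] finite_subset[OF D(1)] by simp_all
    have "card ({x, y} \<union> (C \<union> D)) \<le> card {x, y} + card (C \<union> D)"
      by (rule card_Un_le)
    also have "\<dots> \<le> 2 + 2 * (m - 1)"
      using card_Un_le[of C D] C(2) D(2) xy(3) by simp
    also have "\<dots> \<le> 2 * m + 1"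
      using m by simp
    finally obtain G where G: "G \<subseteq> ?N - ({x, y} \<union> (C \<union> D))" "card G = m - 1"
      using room[of "{x, y} \<union> (C \<union> D)"] fin by auto
    have "insert x G \<in> F \<and> insert y G \<notin> F"
      using disjoint_exchange[OF xy C(1,2) _ _ _ C(3,4), of G] G by (auto simp: disjnt_def)
    then show ?thesis
      using disjoint_exchange[OF xy _ G(2) D, of ] G by (auto simp: disjnt_def)
  qed
  have out: "v \<notin> F" if v: "v \<in> ?V" "x \<notin> v" for v
  proof (cases "y \<in> v")
    case True
    have "insert y (v - {y}) \<notin> F"
      using every_exchange[of "v - {y}"] kneser_verticesD[OF v(1)] True v(2) by auto
    with True show ?thesis
      by (simp add: insert_absorb)
  next
    case False
    have "card ({x, y} \<union> v) \<le> card {x, y} + card v"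
      by (rule card_Un_le)
    also have "\<dots> \<le> 2 * m + 1"
      using kneser_verticesD(2)[OF v(1)] xy(3) m by simp
    finally obtain G where G: "G \<subseteq> ?N - ({x, y} \<union> v)" "card G = m - 1"
      using room[of "{x, y} \<union> v"] kneser_verticesD(3)[OF v(1)] by auto
    have xG: "insert x G \<in> F" "insert x G \<in> ?V"
      using every_exchange[of G] insert_vertex[of x G] xy(1) G by auto
    have "\<exists>E\<in>kneser_edges k m. {v, insert x G} \<subseteq> E"
      using m v G xG k
      by (intro extend_to_kneser_edge)
        (auto simp: pairwise_insert disjnt_def card_insert_if)
    then obtain E where E: "E \<in> kneser_edges k m" "v \<in> E" "insert x G \<in> E"
      by auto
    then show ?thesis
      using card_Int_eq_1_unique[OF one[OF E(1)] E(2,3)] xG v(2) by auto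
  qed
  have "v \<in> F" if v: "v \<in> ?V" "x \<in> v" for v
  proof -
    have "\<exists>E\<in>kneser_edges k m. {v} \<subseteq> E"
      using m v k by (intro extend_to_kneser_edge) auto
    then obtain E where E: "E \<in> kneser_edges k m" "v \<in> E"
      by auto
    obtain w where w: "w \<in> E" "w \<in> F"
      using one[OF E(1)] by (metis IntE card_1_singletonE insertI1)
    have "w \<in> ?V"
      using w(1) kneser_edgesD(1)[OF E(1)] by blast
    then have "x \<in> w"
      using out w(2) by blast
    then have "w = v"
      using kneser_edgesD(3)[OF E(1)] E(2) w(1) v(2) by (auto simp: pairwise_def disjnt_def)
    with w show ?thesis
      by simp
  qed
  with out xy(1) show ?thesis
    by blast
qed

text \<open>
  For each \<open>i\<close> the vertices whose image contains \<open>i\<close> meet every edge exactly once, so they are the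
  vertices containing some \<open>j i\<close>. Thus the image of \<open>v\<close> is the preimage of \<open>v\<close> under \<open>j\<close>, and all
  \<open>m\<close>-element sets have preimages of the same size \<open>n\<close>. Then all fibres of \<open>j\<close> have the same size
  \<open>w\<close>, and \<open>n = m * w\<close>.
\<close>

lemma kneser_hom_dvd:
  assumes k: "k \<ge> 3" and m: "m \<ge> 1"
    and hom: "\<And>E. E \<in> kneser_edges k m \<Longrightarrow> f ` E \<in> kneser_edges k n"
  shows "m dvd n"
proof -
  let ?N = "{1..k * m}" and ?M = "{1..k * n}"
  have vertex_in_edge: "\<exists>E\<in>kneser_edges k m. v \<in> E" if "v \<in> kneser_vertices k m" for v
    using extend_to_kneser_edge[of m "{v}" k] that k m by auto
  have fV: "f v \<in> kneser_vertices k n" if "v \<in> kneser_vertices k m" for v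
    using vertex_in_edge[OF that] hom kneser_edgesD(1) by blast
  have "\<exists>x\<in>?N. \<forall>v\<in>kneser_vertices k m. v \<in> {v. i \<in> f v} \<longleftrightarrow> x \<in> v" if i: "i \<in> ?M" for i
  proof (rule exact_transversal_is_star[OF k m])
    fix E assume E: "E \<in> kneser_edges k m"
    have inj: "inj_on f E"
      using kneser_edgesD(2,4)[OF E] kneser_edgesD(2)[OF hom[OF E]]
      by (intro eq_card_imp_inj_on) auto
    obtain v where v: "v \<in> E" "i \<in> f v"
      using Union_kneser_edge[OF hom[OF E]] i by (metis UnionE imageE)
    have "w = v" if w: "w \<in> E" "i \<in> f w" for w
    proof -
      have "f w = f v"
        using kneser_edgesD(3)[OF hom[OF E]] w v by (auto simp: pairwise_def disjnt_def)
      then show ?thesis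
        using inj w v by (auto dest: inj_onD)
    qed
    then have "E \<inter> {v. i \<in> f v} = {v}"
      using v by blast
    then show "card (E \<inter> {v. i \<in> f v}) = 1"
      by simp
  qed
  then obtain j where j: "\<And>i v. i \<in> ?M \<Longrightarrow> v \<in> kneser_vertices k m \<Longrightarrow> i \<in> f v \<longleftrightarrow> j i \<in> v"
    by (simp only: mem_Collect_eq) metis
  define w where "w x = card {i\<in>?M. j i = x}" for x
  have weight: "(\<Sum>x\<in>v. w x) = n" if v: "v \<in> kneser_vertices k m" for v
  proof -
    have "f v = {i\<in>?M. j i \<in> v}"
      using j[OF _ v] kneser_verticesD(1)[OF fV[OF v]] by blast
    also have "\<dots> = (\<Union>x\<in>v. {i\<in>?M. j i = x})"
      by blast
    also have "card \<dots> = (\<Sum>x\<in>v. w x)"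
      unfolding w_def using kneser_verticesD(3)[OF v] by (intro card_UN_disjoint) auto
    finally show ?thesis
      using kneser_verticesD(2)[OF fV[OF v]] by simp
  qed
  have const: "w x = w y" if xy: "x \<in> ?N" "y \<in> ?N" "x \<noteq> y" for x y
  proof -
    have "card (?N - {x, y}) = k * m - 2"
      using xy by (simp add: card_Diff_subset)
    moreover have "3 * m \<le> k * m"
      using k by simp
    ultimately have "m - 1 \<le> card (?N - {x, y})"
      using m by linarith
    then obtain C where C: "C \<subseteq> ?N - {x, y}" "card C = m - 1"
      using obtain_subset_with_card_n by metis
    have "finite C"
      using C(1) finite_subset by auto
    then have "insert x C \<in> kneser_vertices k m" "insert y C \<in> kneser_vertices k m"
      using C xy m by (auto simp: kneser_vertices_def card_insert_if)
    then have "(\<Sum>x\<in>insert x C. w x) = (\<Sum>x\<in>insert y C. w x)"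
      by (simp only: weight)
    then show ?thesis
      using \<open>finite C\<close> C(1) by (subst (asm) (1 2) sum.insert) auto
  qed
  have "{1..m} \<in> kneser_vertices k m"
    using k by (auto simp: kneser_vertices_def intro: order_trans[of _ m])
  then have "n = (\<Sum>x\<in>{1..m}. w x)"
    using weight by simp
  also have "\<dots> = (\<Sum>x\<in>{1..m}. w 1)"
  proof (rule sum.cong)
    fix x assume x: "x \<in> {1..m}"
    have "m \<le> k * m"
      using mult_le_mono1[of 1 k m] k by linarith
    with x have "x \<in> ?N" "1 \<in> ?N"
      unfolding atLeastAtMost_iff by linarith+
    then show "w x = w 1"
      using const[of x 1] by (cases "x = 1") auto
  qed simp
  finally show ?thesis
    by simp
qed

section \<open>Kneser identities in semirings of sets\<close>

lemma adjoin_zero_simps: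
  "carrier (adjoin_zero A) = insert None (Some ` carrier A)"
  "add (adjoin_zero A) None y = y"
  "add (adjoin_zero A) x None = x"
  "add (adjoin_zero A) (Some a) (Some b) = Some (add A a b)"
  "mul (adjoin_zero A) None y = None"
  "mul (adjoin_zero A) x None = None"
  "mul (adjoin_zero A) (Some a) (Some b) = Some (mul A a b)"
  by (simp_all add: adjoin_zero_def split: option.split)

lemma sum_term_Cons: "ts \<noteq> [] \<Longrightarrow> sum_term (t # ts) = Plus t (sum_term ts)"
  by (cases ts) auto

lemma word_singleton: "word [v] = Var (X v)"
  by (simp add: word_def)

lemma word_Cons: "vs \<noteq> [] \<Longrightarrow> word (v # vs) = Times (Var (X v)) (word vs)"
  by (cases vs) (auto simp: word_def)

lemma eval_word_eq_None_iff:
  assumes "vs \<noteq> []"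
  shows "eval (adjoin_zero A) e (word vs) = None \<longleftrightarrow> (\<exists>v\<in>set vs. e (X v) = None)"
  using assms
proof (induction vs rule: list_nonempty_induct)
  case (single v)
  then show ?case
    by (simp add: word_singleton)
next
  case (cons v vs)
  then show ?case
    by (cases "e (X v)"; cases "eval (adjoin_zero A) e (word vs)")
      (auto simp: word_Cons adjoin_zero_simps)
qed

lemma sorted_wrt_disjnt_iff:
  assumes "distinct vs"
  shows "sorted_wrt (\<lambda>v w. disjnt (f v) (f w)) vs \<longleftrightarrow> pairwise (\<lambda>v w. disjnt (f v) (f w)) (set vs)"
  using assms by (induction vs) (auto simp: pairwise_insert disjnt_sym)

lemma eval_word_set_algebra:
  assumes "vs \<noteq> []" and "\<And>v. v \<in> set vs \<Longrightarrow> e (X v) = Some (Some (f v))"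
  shows "eval (adjoin_zero (set_algebra n p)) e (word vs) =
    Some (if sorted_wrt (\<lambda>v w. disjnt (f v) (f w)) vs then Some (\<Union> (f ` set vs)) else None)"
  using assms
proof (induction vs rule: list_nonempty_induct)
  case (single v)
  then show ?case
    by (simp add: word_singleton)
next
  case (cons v vs)
  then have "e (X v) = Some (Some (f v))"
    by simp
  moreover have "disjnt (f v) (\<Union> (f ` set vs)) \<longleftrightarrow> (\<forall>w\<in>set vs. disjnt (f v) (f w))"
    by (auto simp: disjnt_def)
  ultimately show ?case
    using cons by (simp add: word_Cons adjoin_zero_simps set_algebra_simps)
qed

lemma factors_if_eval_word_set_algebra:
  assumes "vs \<noteq> []" and "eval (adjoin_zero (set_algebra n p)) e (word vs) = Some (Some T)"
    and "v \<in> set vs"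
  shows "\<exists>U. e (X v) = Some (Some U)"
  using assms
proof (induction vs arbitrary: T rule: list_nonempty_induct)
  case (single v)
  then show ?case
    by (simp add: word_singleton)
next
  case (cons w vs)
  obtain a b where ab: "e (X w) = Some a" "eval (adjoin_zero (set_algebra n p)) e (word vs) = Some b"
    "mul (set_algebra n p) a b = Some T"
    using cons.prems(1) cons.hyps
    by (cases "e (X w)"; cases "eval (adjoin_zero (set_algebra n p)) e (word vs)")
      (simp_all add: word_Cons adjoin_zero_simps)
  then obtain U W where "a = Some U" "b = Some W"
    by (cases a; cases b) (simp_all add: set_algebra_simps)
  then show ?case
    using cons.IH cons.prems(2) ab by auto
qed

lemma eval_sum_term_eq_None_iff:
  assumes "ts \<noteq> []"
  shows "eval (adjoin_zero A) e (sum_term ts) = None \<longleftrightarrow> (\<forall>t\<in>set ts. eval (adjoin_zero A) e t = None)"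
  using assms
proof (induction ts rule: list_nonempty_induct)
  case (single t)
  then show ?case
    by simp
next
  case (cons t ts)
  then show ?case
    by (cases "eval (adjoin_zero A) e t"; cases "eval (adjoin_zero A) e (sum_term ts)")
      (auto simp: sum_term_Cons adjoin_zero_simps)
qed

lemma eval_sum_term_const:
  assumes "ts \<noteq> []" and "\<And>t. t \<in> set ts \<Longrightarrow> eval A e t = c" and "add A c c = c"
  shows "eval A e (sum_term ts) = c"
  using assms(1,2)
proof (induction ts rule: list_nonempty_induct)
  case (cons t ts)
  with assms(3) show ?case
    by (simp add: sum_term_Cons)
qed simp

lemma summand_if_eval_sum_term_set_algebra:
  assumes "ts \<noteq> []" and "eval (adjoin_zero (set_algebra n p)) e (sum_term ts) = Some (Some T)"
    and "t \<in> set ts" and "eval (adjoin_zero (set_algebra n p)) e t \<noteq> None"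
  shows "eval (adjoin_zero (set_algebra n p)) e t = Some (Some T)"
  using assms
proof (induction ts rule: list_nonempty_induct)
  case (single u)
  then show ?case
    by simp
next
  case (cons u ts)
  let ?u = "eval (adjoin_zero (set_algebra n p)) e u"
    and ?s = "eval (adjoin_zero (set_algebra n p)) e (sum_term ts)"
  consider "?u = None" "?s = Some (Some T)" | "?u = Some (Some T)" "?s = None"
    | "?u = Some (Some T)" "?s = Some (Some T)"
    using cons.prems(1) cons.hyps
    by (cases ?u; cases ?s)
      (auto simp: sum_term_Cons adjoin_zero_simps set_algebra_simps split: if_splits)
  then show ?case
  proof cases
    case 2
    then show ?thesis
      using cons.prems(2,3) eval_sum_term_eq_None_iff[OF cons.hyps, of "set_algebra n p" e] by auto
  qed (use cons in auto)
qed

lemma kneser_t_obtain: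
  assumes "m \<ge> 1"
  obtains ws where "ws \<noteq> []" "kneser_t k m = sum_term (map word ws)"
    and "set ws = {vs. length vs = k \<and> set vs \<in> kneser_edges k m}"
proof -
  let ?W = "{vs. length vs = k \<and> set vs \<in> kneser_edges k m}"
  define ws where "ws = (SOME ws. distinct ws \<and> set ws = ?W)"
  have "?W \<subseteq> {vs. set vs \<subseteq> kneser_vertices k m \<and> length vs = k}"
    using kneser_edgesD(1) by blast
  then have "finite ?W"
    using finite_lists_length_eq[OF finite_kneser_vertices] finite_subset by blast
  moreover have "\<exists>ws. distinct ws \<and> set ws = W" if "finite W" for W :: "nat set list set"
    using finite_distinct_list[OF that] by blast
  ultimately have ws: "distinct ws \<and> set ws = ?W"
    unfolding ws_def by (intro someI_ex[of "\<lambda>ws. distinct ws \<and> set ws = ?W"]) blast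
  obtain E where E: "E \<in> kneser_edges k m"
    using extend_to_kneser_edge[OF assms, of "{}" k] by auto
  then obtain vs where "set vs = E" "distinct vs"
    using finite_distinct_list[OF kneser_edgesD(4)] by blast
  with E have "vs \<in> ?W"
    using kneser_edgesD(2)[OF E] distinct_card[of vs] by simp
  with ws have "ws \<noteq> []"
    by auto
  then show thesis
    using that ws unfolding kneser_t_def ws_def by blast
qed

text \<open>
  Send \<open>x\<^sub>v\<close> to the set \<open>v\<close> and \<open>y\<close> to the adjoined zero. Then all the words of the sum take the
  value \<open>{1..k * p}\<close>, while the product over all vertices contains overlapping sets.
\<close>

lemma set_algebra_violates_kneser_identity:
  assumes k: "k \<ge> 2" and p: "p \<ge> 2"
    and ord: "distinct (ord p)" "set (ord p) = kneser_vertices k p"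
  shows "\<not> satisfies (adjoin_zero (set_algebra (k * p) p)) (kneser_identity k ord p)"
proof
  let ?A = "adjoin_zero (set_algebra (k * p) p)" and ?V = "kneser_vertices k p"
  define e where "e x = (case x of X v \<Rightarrow> if v \<in> ?V then Some (Some v) else None | Y \<Rightarrow> None)" for x
  have e: "e (X v) = Some (Some v)" if "v \<in> ?V" for v
    using that by (simp add: e_def)
  have "e x \<in> carrier ?A" for x
    using p by (cases x) (auto simp: e_def adjoin_zero_simps set_algebra_def kneser_vertices_def
        intro!: imageI)
  then have range: "range e \<subseteq> carrier ?A"
    by auto
  obtain ws where ws: "ws \<noteq> []" "kneser_t k p = sum_term (map word ws)"
    "set ws = {vs. length vs = k \<and> set vs \<in> kneser_edges k p}"
    using kneser_t_obtain[of p k] p by auto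
  have "eval ?A e (word vs) = Some (Some {1..k * p})" if "vs \<in> set ws" for vs
  proof -
    have vs: "length vs = k" "set vs \<in> kneser_edges k p"
      using that ws(3) by auto
    note E = kneser_edgesD[OF vs(2)]
    have "vs \<noteq> []" "distinct vs"
      using k vs(1) E(2) by (auto intro: card_distinct)
    moreover have "sorted_wrt (\<lambda>v w. disjnt v w) vs"
      using sorted_wrt_disjnt_iff[OF \<open>distinct vs\<close>, of "\<lambda>v. v"] E(3) by simp
    ultimately show ?thesis
      using eval_word_set_algebra[of vs e "\<lambda>v. v"] e E(1) Union_kneser_edge[OF vs(2)] by auto
  qed
  then have t: "eval ?A e (kneser_t k p) = Some (Some {1..k * p})"
    unfolding ws(2) using ws(1)
    by (intro eval_sum_term_const) (auto simp: adjoin_zero_simps set_algebra_simps)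
  have "2 * p \<le> k * p"
    using k by simp
  then have "Suc p \<le> k * p"
    using p by linarith
  then have V: "{1..p} \<in> ?V" "{2..p + 1} \<in> ?V"
    using k by (auto simp: kneser_vertices_def)
  have "1 \<in> {1..p} - {2..p + 1}" "2 \<in> {1..p} \<inter> {2..p + 1}"
    using p by auto
  then have "{1..p} \<noteq> {2..p + 1}" "\<not> disjnt {1..p} {2..p + 1}"
    unfolding disjnt_def by blast+
  then have "\<not> sorted_wrt (\<lambda>v w. disjnt v w) (ord p)"
    using sorted_wrt_disjnt_iff[OF ord(1), of "\<lambda>v. v"] V unfolding ord(2) pairwise_def by blast
  moreover have "ord p \<noteq> []"
    using ord(2) V by auto
  ultimately have q: "eval ?A e (kneser_q ord p) = Some None"
    unfolding kneser_q_def using eval_word_set_algebra[of "ord p" e "\<lambda>v. v"] e ord(2) by auto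
  assume "satisfies ?A (kneser_identity k ord p)"
  then have "eval ?A e (fst (kneser_identity k ord p)) = eval ?A e (snd (kneser_identity k ord p))"
    using range by (simp add: satisfies_def)
  then show False
    using t q by (simp add: kneser_identity_def Let_def adjoin_zero_simps set_algebra_simps e_def)
qed

text \<open>
  A value of \<open>y\<close> other than the adjoined zero makes both sides the greatest element. Otherwise the
  sides can only differ if the sum of the words takes as value a set. Then the variables of each
  word take disjoint sets as values, with the same union for all words. Having at least \<open>n\<close> elements
  each, they have exactly \<open>n\<close> elements, and so the assignment is a homomorphism of Kneser hypergraphs.
\<close>

lemma set_algebra_satisfies_kneser_identity:
  assumes k: "k \<ge> 3" and m: "m \<ge> 1" and n: "n \<ge> 1" and not_dvd: "\<not> m dvd n"
    and ord: "set (ord m) = kneser_vertices k m"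
  shows "satisfies (adjoin_zero (set_algebra (k * n) n)) (kneser_identity k ord m)"
  unfolding satisfies_def
proof (intro allI impI)
  let ?B = "set_algebra (k * n) n"
  let ?A = "adjoin_zero ?B" and ?V = "kneser_vertices k m"
  fix e :: "kvar \<Rightarrow> nat set option option"
  assume range: "range e \<subseteq> carrier ?A"
  let ?t = "eval ?A e (kneser_t k m)" and ?q = "eval ?A e (kneser_q ord m)"
  have top: "add ?A x (Some None) = Some None" "add ?A (Some None) x = Some None" for x
    by (cases x; simp add: adjoin_zero_simps set_algebra_simps)+
  obtain ws where ws: "ws \<noteq> []" "kneser_t k m = sum_term (map word ws)"
    "set ws = {vs. length vs = k \<and> set vs \<in> kneser_edges k m}"
    using kneser_t_obtain[OF m] by blast
  obtain E where E: "E \<in> kneser_edges k m"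
    using extend_to_kneser_edge[OF m, of "{}" k] by auto
  then have "E \<noteq> {}"
    using kneser_edgesD(2)[OF E] k by auto
  then have ne: "ord m \<noteq> []"
    using ord kneser_edgesD(1)[OF E] by auto
  have words: "vs \<noteq> []" "set vs \<subseteq> ?V" if "vs \<in> set ws" for vs
    using that k ws(3) kneser_edgesD(1) by auto
  have sum: "add ?A ?t ?q = ?t" if defined: "\<And>v. v \<in> ?V \<Longrightarrow> e (X v) \<noteq> None"
  proof -
    have word_defined: "eval ?A e (word vs) \<noteq> None" if "vs \<in> set ws" for vs
      using eval_word_eq_None_iff[OF words(1)[OF that]] words(2)[OF that] defined by blast
    have "eval ?A e (word (hd ws)) \<noteq> None"
      using word_defined ws(1) by simp
    moreover have "word (hd ws) \<in> set (map word ws)"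
      using ws(1) by simp
    ultimately have "?t \<noteq> None"
      using eval_sum_term_eq_None_iff[of "map word ws" ?B e] ws(1,2) by auto
    moreover have "?t \<noteq> Some (Some T)" for T
    proof
      assume T: "?t = Some (Some T)"
      define f where "f v = the (the (e (X v)))" for v
      have "f ` E \<in> kneser_edges k n" if E: "E \<in> kneser_edges k m" for E
      proof -
        note E' = kneser_edgesD[OF E]
        obtain vs where vs: "set vs = E" "distinct vs"
          using finite_distinct_list[OF E'(4)] by blast
        have "vs \<in> set ws"
          using ws(3) vs E E'(2) distinct_card[OF vs(2)] by auto
        have "eval ?A e (word vs) = Some (Some T)"
          using summand_if_eval_sum_term_set_algebra[of "map word ws" _ _ e T "word vs"]
            T ws(1,2) word_defined[OF \<open>vs \<in> set ws\<close>] \<open>vs \<in> set ws\<close> by simp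
        have f: "e (X v) = Some (Some (f v))" if "v \<in> E" for v
          using factors_if_eval_word_set_algebra[OF words(1)[OF \<open>vs \<in> set ws\<close>]
              \<open>eval ?A e (word vs) = Some (Some T)\<close>, of v] that vs(1)
          by (auto simp: f_def)
        have disj: "pairwise (\<lambda>v w. disjnt (f v) (f w)) E" and T_eq: "T = \<Union> (f ` E)"
          using eval_word_set_algebra[OF words(1)[OF \<open>vs \<in> set ws\<close>], of e f] f vs
            \<open>eval ?A e (word vs) = Some (Some T)\<close> sorted_wrt_disjnt_iff[OF vs(2), of f]
          by (auto split: if_splits)
        have val: "f v \<subseteq> {1..k * n}" "f v \<noteq> {}" "n dvd card (f v)" if "v \<in> E" for v
          using range_subsetD[OF range, of "X v"] f[OF that]
          by (auto simp: adjoin_zero_simps set_algebra_def)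
        have fin: "finite (f v)" if "v \<in> E" for v
          using finite_subset[OF val(1)[OF that]] by simp
        have "f v \<noteq> f w" if "v \<in> E" "w \<in> E" "v \<noteq> w" for v w
          using disj val(2)[OF that(1)] that by (auto simp: pairwise_def disjnt_def)
        then have inj: "inj_on f E"
          by (meson inj_onI)
        have ge: "n \<le> card (f v)" if "v \<in> E" for v
          using dvd_imp_le[OF val(3)[OF that]] val(2)[OF that] fin[OF that]
          by (simp add: card_gt_0_iff)
        have "(\<Sum>v\<in>E. card (f v)) = card T"
          unfolding T_eq using disj fin E'(4)
          by (intro card_UN_disjoint[symmetric]) (auto simp: pairwise_def disjnt_def)
        also have "\<dots> \<le> card {1..k * n}"
          unfolding T_eq using val(1) by (intro card_mono) auto
        finally have le: "(\<Sum>v\<in>E. card (f v)) \<le> (\<Sum>v\<in>E. n)"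
          using E'(2) by simp
        have "card (f v) = n" if "v \<in> E" for v
        proof (rule ccontr)
          assume "card (f v) \<noteq> n"
          then have "(\<Sum>v\<in>E. n) < (\<Sum>v\<in>E. card (f v))"
            using ge that E'(4) by (intro sum_strict_mono_ex1) (auto simp: le_less)
          with le show False
            by simp
        qed
        then have "f ` E \<subseteq> kneser_vertices k n"
          using val(1) by (auto simp: kneser_vertices_def)
        moreover have "pairwise disjnt (f ` E)"
          using disj by (auto simp: pairwise_def)
        ultimately show ?thesis
          using E'(2) card_image[OF inj] by (simp add: kneser_edges_def)
      qed
      then show False
        using kneser_hom_dvd[OF k m] not_dvd by blast
    qed
    ultimately have "?t = Some None"
      by (metis not_None_eq)
    then show ?thesis
      by (simp add: top)
  qed
  show "eval ?A e (fst (kneser_identity k ord m)) = eval ?A e (snd (kneser_identity k ord m))"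
  proof (cases "e Y")
    case (Some b)
    then have "b \<in> carrier ?B"
      using range_subsetD[OF range, of Y] by (auto simp: adjoin_zero_simps)
    then have "mul ?B b b = None"
      by (cases b) (auto simp: set_algebra_def disjnt_def)
    with Some show ?thesis
      by (simp add: kneser_identity_def Let_def adjoin_zero_simps(7) top)
  next
    case None
    have "add ?A ?t ?q = ?t"
    proof (cases "\<exists>v\<in>?V. e (X v) = None")
      case True
      then have "?q = None"
        unfolding kneser_q_def eval_word_eq_None_iff[OF ne] ord .
      then show ?thesis
        by (simp add: adjoin_zero_simps)
    next
      case False
      then show ?thesis
        by (intro sum) auto
    qed
    with None show ?thesis
      by (simp add: kneser_identity_def Let_def adjoin_zero_simps(3,5))
  qed
qed

section \<open>Chains and antichains of subsets of a countable set\<close>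

text \<open>The Dedekind cuts of the rationals form a chain that is indexed by the reals.\<close>

lemma chain_of_nat_sets:
  obtains c :: "real \<Rightarrow> nat set" where "inj c" "\<And>r s. c r \<subseteq> c s \<or> c s \<subseteq> c r"
proof
  let ?c = "\<lambda>r. {n. real_of_rat (nat_to_rat_surj n) < r}"
  show "?c r \<subseteq> ?c s \<or> ?c s \<subseteq> ?c r" for r s
    by (cases "r \<le> s") auto
  have distinct: "?c r \<noteq> ?c s" if rs: "r < s" for r s
  proof -
    obtain q where q: "r < real_of_rat q" "real_of_rat q < s"
      using of_rat_dense[OF rs] by blast
    obtain n where "q = nat_to_rat_surj n"
      using surj_nat_to_rat_surj by (metis surjD)
    with q have "n \<in> ?c s" "n \<notin> ?c r"
      by auto
    then show ?thesis
      by blast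
  qed
  show "inj ?c"
  proof (rule injI)
    fix r s assume "?c r = ?c s"
    then show "r = s"
      using distinct[of r s] distinct[of s r] by (cases r s rule: linorder_cases) simp_all
  qed
qed

text \<open>
  Recording membership of \<open>n\<close> by \<open>2 * n\<close> and non-membership by \<open>2 * n + 1\<close> makes distinct sets
  incomparable.
\<close>

lemma antichain_of_nat_sets:
  obtains d :: "nat set \<Rightarrow> nat set" where "\<And>A B. d A \<subseteq> d B \<longleftrightarrow> A = B"
proof
  let ?d = "\<lambda>A. {m. m div 2 \<in> A \<longleftrightarrow> even m}"
  have mem: "2 * n \<in> ?d A \<longleftrightarrow> n \<in> A" "2 * n + 1 \<in> ?d A \<longleftrightarrow> n \<notin> A" for n :: nat and A :: "nat set"
    by simp_all
  show "?d A \<subseteq> ?d B \<longleftrightarrow> A = B" for A B :: "nat set"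
  proof
    assume sub: "?d A \<subseteq> ?d B"
    have "n \<in> A \<longleftrightarrow> n \<in> B" for n
      using subsetD[OF sub, of "2 * n"] subsetD[OF sub, of "2 * n + 1"] unfolding mem by blast
    then show "A = B"
      by blast
  qed simp
qed

lemma continuum_chain_and_antichain:
  fixes J :: "'a set set" and V :: "nat set \<Rightarrow> 'a set"
  assumes J: "J \<lesssim> (UNIV :: nat set set)"
    and V: "\<And>A. V A \<in> J" "\<And>A B. V A \<subseteq> V B \<longleftrightarrow> B \<subseteq> A"
  shows "J \<approx> (UNIV :: nat set set)
    \<and> (\<exists>C\<subseteq>J. (\<forall>V\<in>C. \<forall>W\<in>C. V \<subseteq> W \<or> W \<subseteq> V) \<and> C \<approx> (UNIV :: nat set set))
    \<and> (\<exists>D\<subseteq>J. (\<forall>V\<in>D. \<forall>W\<in>D. V \<noteq> W \<longrightarrow> \<not> V \<subseteq> W) \<and> D \<approx> (UNIV :: nat set set))"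
proof (intro conjI)
  have injV: "inj V"
    using V(2) by (metis injI order_refl subset_antisym)
  then have "(UNIV :: nat set set) \<lesssim> J"
    using V(1) unfolding lepoll_def by blast
  with J show "J \<approx> (UNIV :: nat set set)"
    by (rule lepoll_antisym)
  obtain c :: "real \<Rightarrow> nat set" where c: "inj c" "\<And>r s. c r \<subseteq> c s \<or> c s \<subseteq> c r"
    using chain_of_nat_sets by blast
  have "inj (V \<circ> c)"
    using injV c(1) by (rule inj_compose)
  then have "range (V \<circ> c) \<approx> (UNIV :: nat set set)"
    by (meson eqpoll_sym eqpoll_trans inj_on_image_eqpoll_self nat_sets_eqpoll_reals)
  moreover have "\<forall>X\<in>range (V \<circ> c). \<forall>Y\<in>range (V \<circ> c). X \<subseteq> Y \<or> Y \<subseteq> X"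
    using c(2) by (auto simp: V(2))
  ultimately show "\<exists>C\<subseteq>J. (\<forall>V\<in>C. \<forall>W\<in>C. V \<subseteq> W \<or> W \<subseteq> V) \<and> C \<approx> (UNIV :: nat set set)"
    using V(1) by (intro exI[of _ "range (V \<circ> c)"]) auto
  obtain d :: "nat set \<Rightarrow> nat set" where d: "\<And>A B. d A \<subseteq> d B \<longleftrightarrow> A = B"
    using antichain_of_nat_sets by blast
  have "inj d"
    using d by (metis injI order_refl)
  with injV have "inj (V \<circ> d)"
    by (rule inj_compose)
  then have "range (V \<circ> d) \<approx> (UNIV :: nat set set)"
    by (rule inj_on_image_eqpoll_self)
  moreover have "\<forall>X\<in>range (V \<circ> d). \<forall>Y\<in>range (V \<circ> d). X \<noteq> Y \<longrightarrow> \<not> X \<subseteq> Y"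
    using d by (auto simp: V(2))
  ultimately show "\<exists>D\<subseteq>J. (\<forall>V\<in>D. \<forall>W\<in>D. V \<noteq> W \<longrightarrow> \<not> V \<subseteq> W) \<and> D \<approx> (UNIV :: nat set set)"
    using V(1) by (intro exI[of _ "range (V \<circ> d)"]) auto
qed

section \<open>The interval\<close>

instance ai_term :: (countable) countable
  by countable_datatype

lemma varieties_lepoll_nat_sets: "{V :: 'u ai_alg set. variety V} \<lesssim> (UNIV :: nat set set)"
proof -
  have "{V :: 'u ai_alg set. variety V} = range (models :: nat identity set \<Rightarrow> 'u ai_alg set)"
    by (auto simp: variety_def)
  then have "{V :: 'u ai_alg set. variety V} \<lesssim> (UNIV :: nat identity set set)"
    by (simp add: image_lepoll)
  moreover have "inj (image (to_nat :: nat identity \<Rightarrow> nat))"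
    by (intro inj_on_image) simp
  then have "(UNIV :: nat identity set set) \<lesssim> (UNIV :: nat set set)"
    unfolding lepoll_def by blast
  ultimately show ?thesis
    by (rule lepoll_trans)
qed

theorem theorem3p6:
  fixes k :: nat
    and ord :: "nat \<Rightarrow> nat set list"
    and S :: "'a ai_alg"
  assumes infinite_universe: "infinite (UNIV :: 'u set)"
    and k: "k \<ge> 3"
    and ord: "vertex_orders k ord"
    and S: "ai_semiring S"
    and lower: "(variety_generated S7 :: 'u ai_alg set) \<subseteq> variety_generated S"
    and upper: "(variety_generated S :: 'u ai_alg set) \<subseteq> kneser_variety k ord"
  defines "J \<equiv> (variety_interval (variety_generated S) (variety_generated (adjoin_zero S))
                  :: 'u ai_alg set set)"
  shows "J \<approx> (UNIV :: nat set set)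
    \<and> (\<exists>C\<subseteq>J. (\<forall>V\<in>C. \<forall>W\<in>C. V \<subseteq> W \<or> W \<subseteq> V) \<and> C \<approx> (UNIV :: nat set set))
    \<and> (\<exists>D\<subseteq>J. (\<forall>V\<in>D. \<forall>W\<in>D. V \<noteq> W \<longrightarrow> \<not> V \<subseteq> W) \<and> D \<approx> (UNIV :: nat set set))"
proof -
  have S0: "ai_semiring (adjoin_zero S)"
    using S by (rule ai_semiring_adjoin_zero)
  have S_ne: "carrier S \<noteq> {}"
    using S by (rule ai_semiring.nonempty)
  define \<pi> :: "nat \<Rightarrow> nat" where "\<pi> = enumerate {p. prime p}"
  have prime: "prime (\<pi> n)" for n
    using enumerate_in_set[OF primes_infinite, of n] by (simp add: \<pi>_def)
  have inj: "\<pi> m = \<pi> n \<longleftrightarrow> m = n" for m n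
    using strict_mono_eq[OF strict_mono_enumerate[OF primes_infinite]] by (simp add: \<pi>_def)
  define identity where "identity n = nat_identity (kneser_identity k ord (\<pi> n))" for n
  define V :: "nat set \<Rightarrow> 'u ai_alg set" where
    "V A = models ({i. satisfies (adjoin_zero S) i} \<union> identity ` A)" for A
  have "V A \<in> J" for A
    unfolding J_def variety_interval_def
  proof (intro CollectI conjI)
    show "variety (V A)"
      unfolding variety_def V_def by blast
    show "V A \<subseteq> variety_generated (adjoin_zero S)"
      unfolding variety_generated_eq_models[OF S0] V_def models_def by blast
    show "variety_generated S \<subseteq> V A"
    proof
      fix B :: "'u ai_alg" assume B: "B \<in> variety_generated S"
      then have "satisfies B (identity n)" for n
        using upper prime
        unfolding identity_def satisfies_nat_identity_iff kneser_variety_def models_def by blast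
      then show "B \<in> V A"
        using B satisfies_if_satisfies_adjoin_zero[OF S_ne]
        unfolding variety_generated_eq_models[OF S] V_def models_def by blast
    qed
  qed
  moreover have "V A \<subseteq> V B \<longleftrightarrow> B \<subseteq> A" for A B
  proof
    assume "B \<subseteq> A"
    then show "V A \<subseteq> V B"
      unfolding V_def models_def by blast
  next
    assume sub: "V A \<subseteq> V B"
    show "B \<subseteq> A"
    proof (rule ccontr)
      assume "\<not> B \<subseteq> A"
      then obtain n where n: "n \<in> B" "n \<notin> A"
        by blast
      let ?p = "\<pi> n"
      let ?M = "set_algebra (k * ?p) ?p"
      let ?N = "adjoin_zero ?M"
      have p: "?p \<ge> 2"
        using prime by (rule prime_ge_2_nat)
      then have "k * ?p \<ge> 1"
        using k by (simp add: Suc_le_eq)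
      have N: "ai_semiring ?N"
        by (intro ai_semiring_adjoin_zero ai_semiring_set_algebra)
      have "finite (carrier ?N)"
        by (simp add: adjoin_zero_simps finite_set_algebra)
      then obtain C :: "'u ai_alg"
        where C: "ai_semiring C" "\<And>i :: nat identity. satisfies C i \<longleftrightarrow> satisfies ?N i"
        using finite_algebra_copy[OF infinite_universe N] by blast
      have "satisfies ?M i" if "satisfies S i" for i :: "nat identity"
        using that satisfies_if_variety_generated_subset
            [OF infinite_universe ai_semiring_S7 finite_S7 S lower]
          satisfies_set_algebra[OF \<open>k * ?p \<ge> 1\<close>]
        by blast
      then have "satisfies ?N i" if "satisfies (adjoin_zero S) i" for i :: "nat identity"
        using satisfies_adjoin_zero_mono[OF S_ne ai_semiring.nonempty[OF ai_semiring_set_algebra] _ that]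
        by blast
      moreover have "satisfies ?N (identity j)" if "j \<in> A" for j
        unfolding identity_def satisfies_nat_identity_iff
      proof (rule set_algebra_satisfies_kneser_identity)
        have "\<pi> j \<noteq> ?p"
          using that n(2) inj by auto
        then show "\<not> \<pi> j dvd ?p"
          using prime primes_dvd_imp_eq by blast
        show "set (ord (\<pi> j)) = kneser_vertices k (\<pi> j)"
          using ord prime_ge_1_nat[OF prime] by (simp add: vertex_orders_def)
      qed (use k prime prime_ge_1_nat in auto)
      ultimately have "C \<in> V A"
        using C unfolding V_def models_def by auto
      then have "satisfies ?N (identity n)"
        using sub n(1) C(2) unfolding V_def models_def by blast
      moreover have "distinct (ord ?p)" "set (ord ?p) = kneser_vertices k ?p"
        using ord prime_ge_1_nat[OF prime] by (simp_all add: vertex_orders_def)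
      ultimately show False
        unfolding identity_def satisfies_nat_identity_iff
        using set_algebra_violates_kneser_identity[of k ?p ord] k p by simp
    qed
  qed
  moreover have "J \<lesssim> (UNIV :: nat set set)"
    using subset_imp_lepoll[of J "{V. variety V}"] varieties_lepoll_nat_sets lepoll_trans
    unfolding J_def variety_interval_def by blast
  ultimately show ?thesis
    by (intro continuum_chain_and_antichain)
qed

end
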